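(* Let $(X_1,\ldots,X_d)\in M_n(\mathbb{C})^d$ and let $T=\sum_{i=1}^d\overline{X_i}\otimes X_i$. There is a non-negative real eigenvalue $\lambda$ of $T$, with degeneracy index $\eta$, such that for any other eigenvalue $\lambda'$ of $T$, with degeneracy index $\eta'$, one of the following holds: (1) $\lambda=|\lambda'|$ and $\eta\ge\eta'$; or (2) $\lambda>|\lambda'|$. That is, the maximal spectrum of $T$ contains a non-negative real element.
   Context: $\overline{A}$ is the entrywise complex conjugate of a matrix $A$ and $\otimes$ is the Kronecker product. The degeneracy index of an eigenvalue of a square complex matrix is the maximum size of the Jordan blocks corresponding to that eigenvalue. The maximal spectrum of a square matrix $T$ is the set of those eigenvalues of maximum modulus that have the largest degeneracy index among all eigenvalues of maximum modulus. *)

theory Defs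
  imports
    "Jordan_Normal_Form.Jordan_Normal_Form_Existence"
    "Jordan_Normal_Form.Jordan_Normal_Form_Uniqueness"
    "Jordan_Normal_Form.Spectral_Radius"
begin

definition kronecker :: "'a :: times mat \<Rightarrow> 'a mat \<Rightarrow> 'a mat"  (infixl "\<otimes>\<^sub>K" 70)
  where
  "A \<otimes>\<^sub>K B = mat (dim_row A * dim_row B) (dim_col A * dim_col B)
     (\<lambda>(i, j). A $$ (i div dim_row B, j div dim_col B)
             * B $$ (i mod dim_row B, j mod dim_col B))"

text \<open>A square complex matrix has a Jordan normal form, unique up to the order of its blocks,
  so for an eigenvalue the set below is finite and nonempty; see
  \<open>degeneracy_index_eq\<close>. Off the spectrum the set is empty and the value is
  meaningless.\<close>

definition degeneracy_index :: "complex mat \<Rightarrow> complex \<Rightarrow> nat" where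
  "degeneracy_index A \<mu> = Max {k. \<exists>n_as. jordan_nf A n_as \<and> (k, \<mu>) \<in> set n_as}"

lemma degeneracy_index_eq:
  assumes "jordan_nf A n_as"
  shows "degeneracy_index A \<mu> = Max {k. (k, \<mu>) \<in> set n_as}"
proof -
  have "{k. \<exists>m_bs. jordan_nf A m_bs \<and> (k, \<mu>) \<in> set m_bs} = {k. (k, \<mu>) \<in> set n_as}"
    using jordan_nf_unique[OF assms] assms by blast
  then show ?thesis
    by (simp add: degeneracy_index_def)
qed

text \<open>\<open>spectral_radius A\<close> is the maximum modulus of the eigenvalues of \<open>A\<close>.\<close>

definition maximal_spectrum :: "complex mat \<Rightarrow> complex set" where
  "maximal_spectrum A = {\<mu> \<in> spectrum A. cmod \<mu> = spectral_radius A \<and>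
     (\<forall>\<nu> \<in> spectrum A. cmod \<nu> = spectral_radius A \<longrightarrow>
        degeneracy_index A \<nu> \<le> degeneracy_index A \<mu>)}"

end

theory Submission
  imports Defs "HOL-Analysis.Generalised_Binomial_Theorem"
begin

text \<open>
  Every power \<open>T\<^sup>k\<close> is again a sum of matrices \<open>cnj Y \<otimes> Y\<close>. The sum \<open>s k\<close> of the squared Frobenius
  norms of these \<open>Y\<close> is a linear functional of \<open>T\<^sup>k\<close>, is nonnegative, and dominates every entry of
  \<open>T\<^sup>k\<close>. By the Jordan normal form, \<open>s\<close> is a combination of the sequences
  \<open>k \<mapsto> (k choose m) \<mu>\<^bsup>k - m\<^esup>\<close> with \<open>m\<close> below the size of some Jordan block for \<open>\<mu>\<close>, and a block of size
  \<open>\<eta>\<close> for an eigenvalue of modulus \<open>\<rho>\<close>, the spectral radius, forces \<open>(k choose \<eta> - 1) \<rho>\<^bsup>k - \<eta> + 1\<^esup> \<le> C s k\<close>.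
  Multiplying by \<open>x\<^sup>k\<close>, summing, and letting \<open>x\<close> increase to \<open>1 / \<rho>\<close>, the left side
  grows like \<open>(1 - \<rho> x)\<^bsup>-\<eta>\<^esup>\<close>. On the right only Jordan blocks for \<open>\<rho>\<close> itself contribute a pole at
  \<open>1 / \<rho>\<close>, so \<open>\<rho>\<close> has a block of size at least \<open>\<eta>\<close>.
\<close>

section \<open>Exponential polynomials and their generating functions\<close>

text \<open>These are the entries on the \<open>m\<close>-th superdiagonal of the
  \<open>k\<close>-th power of a Jordan block. The truncated exponent \<open>k - m\<close> is
  harmless, since the binomial coefficient vanishes for \<open>k < m\<close>; for
  \<open>\<mu> = 0\<close> the sequence is the indicator of \<open>k = m\<close>.\<close>

definition exp_poly :: "nat \<times> complex \<Rightarrow> nat \<Rightarrow> complex" where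
  "exp_poly = (\<lambda>(m, \<mu>) k. of_nat (k choose m) * \<mu> ^ (k - m))"

text \<open>Negative binomial series of exponent \<open>m + 1\<close> in
  \<open>y = \<mu> * x\<close>, shifted by \<open>m\<close> places. It puts a pole of order
  \<open>m + 1\<close> at \<open>1 / \<mu>\<close> when \<open>\<mu> \<noteq> 0\<close>.\<close>

lemma exp_poly_sums:
  fixes \<mu> x :: complex
  assumes "cmod (\<mu> * x) < 1"
  shows "(\<lambda>k. exp_poly (m, \<mu>) k * x ^ k) sums (x ^ m / (1 - \<mu> * x) ^ Suc m)"
proof -
  define y where "y = \<mu> * x"
  have y: "cmod (- y) < 1" "1 - y \<noteq> 0"
    using assms by (auto simp: y_def)
  have "(\<lambda>k. (-1) ^ k * ((of_nat (Suc m) + of_nat k - 1) gchoose k) * (- y) ^ k)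
          sums (1 + (- y)) powr (- of_nat (Suc m))"
    using one_plus_neg_powr_powser[OF y(1), of "of_nat (Suc m)"] by simp
  moreover have "(-1) ^ k * ((of_nat (Suc m) + of_nat k - 1) gchoose k) * (- y) ^ k
      = of_nat ((k + m) choose m) * y ^ k" for k
  proof -
    have "(of_nat (Suc m) + of_nat k - 1 :: complex) = of_nat (k + m)"
      by simp
    then have "((of_nat (Suc m) + of_nat k - 1 :: complex) gchoose k) = of_nat ((k + m) choose k)"
      by (simp only: binomial_gbinomial)
    also have "(k + m) choose k = (k + m) choose m"
      using binomial_symmetric[of k "k + m"] by simp
    finally show ?thesis
      using power_mult_distrib[of "-1" "- y" k] by (simp add: mult_ac)
  qed
  moreover have "(1 + (- y)) powr (- of_nat (Suc m)) = 1 / (1 - y) ^ Suc m"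
    using y(2) powr_nat'[of "1 - y" "Suc m"] by (simp add: powr_minus divide_simps del: of_nat_Suc)
  ultimately have "(\<lambda>k. of_nat ((k + m) choose m) * y ^ k) sums (1 / (1 - y) ^ Suc m)"
    by simp
  from sums_mult[OF this, of "x ^ m"]
  have "(\<lambda>k. exp_poly (m, \<mu>) (k + m) * x ^ (k + m)) sums (x ^ m / (1 - y) ^ Suc m)"
    by (simp add: exp_poly_def y_def power_add power_mult_distrib mult_ac)
  \<comment> \<open>The first \<open>m\<close> terms are zero, so undoing the shift adds nothing to
    the sum.\<close>
  then show ?thesis
    by (subst (asm) sums_zero_iff_shift) (auto simp: exp_poly_def y_def)
qed

text \<open>A comparison of pole orders at \<open>1 / \<rho>\<close>. Other modes of modulus
  \<open>\<rho>\<close> may be as large in absolute value, but their generating functions have their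
  poles elsewhere on the circle, so they cannot account for growth along the positive axis.\<close>

lemma exp_poly_dominated_imp_mem:
  fixes s :: "nat \<Rightarrow> real" and \<rho> :: real
  assumes B: "finite B" "\<And>m \<mu>. (m, \<mu>) \<in> B \<Longrightarrow> cmod \<mu> \<le> \<rho>" and \<rho>: "\<rho> > 0"
    and s: "\<And>k. of_real (s k) = (\<Sum>b\<in>B. c b * exp_poly b k)"
    and dom: "\<And>k. real (k choose p) * \<rho> ^ (k - p) \<le> C * s k"
  shows "\<exists>m\<ge>p. (m, of_real \<rho>) \<in> B"
proof (rule ccontr)
  assume neg: "\<not> (\<exists>m\<ge>p. (m, of_real \<rho>) \<in> B)"
  define G where "G = (\<lambda>(m, \<mu>) x. x ^ m / (1 - \<mu> * x) ^ Suc m :: complex)"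
  define F where "F = (\<lambda>x :: real. \<Sum>b\<in>B. c b * G b (of_real x))"
  \<comment> \<open>Clearing the denominator \<open>(1 - \<rho> * x) ^ Suc p\<close> gives both
    sides a limit at \<open>1 / \<rho>\<close>. The absolute value of \<open>C\<close> appears
    because its sign is not assumed.\<close>
  have ineq: "x ^ p \<le> \<bar>C\<bar> * cmod ((1 - of_real (\<rho> * x)) ^ Suc p * F x)"
    if x: "0 < x" "x < 1 / \<rho>" for x
  proof -
    have \<rho>x: "\<rho> * x < 1" "0 < \<rho> * x"
      using x \<rho> by (auto simp: field_simps)
    have "(\<lambda>k. of_real (s k) * of_real x ^ k) sums F x"
      unfolding F_def s sum_distrib_right
    proof (rule sums_sum)
      fix b assume b: "b \<in> B"
      obtain m \<mu> where [simp]: "b = (m, \<mu>)" by force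
      have "cmod (\<mu> * of_real x) \<le> \<rho> * x"
        using B(2)[of m \<mu>] b x by (simp add: norm_mult)
      then have "cmod (\<mu> * of_real x) < 1"
        using \<rho>x by simp
      from sums_mult[OF exp_poly_sums[OF this, of m], of "c b"]
      show "(\<lambda>k. c b * exp_poly b k * of_real x ^ k) sums (c b * G b (of_real x))"
        by (simp add: G_def mult_ac)
    qed
    then have S: "(\<lambda>k. of_real (s k * x ^ k)) sums F x"
      by simp
    have ReS: "(\<lambda>k. s k * x ^ k) sums Re (F x)"
      using sums_Re[OF S] by simp
    have "cmod (of_real \<rho> * of_real x) < 1"
      using \<rho>x by (simp add: norm_mult)
    from sums_Re[OF exp_poly_sums[OF this, of p]]
    have "(\<lambda>k. Re (of_real (real (k choose p) * \<rho> ^ (k - p) * x ^ k)))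
            sums Re (of_real (x ^ p / (1 - \<rho> * x) ^ Suc p))"
      by (simp add: exp_poly_def)
    then have E: "(\<lambda>k. real (k choose p) * \<rho> ^ (k - p) * x ^ k)
            sums (x ^ p / (1 - \<rho> * x) ^ Suc p)"
      unfolding Re_complex_of_real .
    have "x ^ p / (1 - \<rho> * x) ^ Suc p \<le> C * Re (F x)"
      by (rule sums_le[OF _ E sums_mult[OF ReS]])
        (use dom x in \<open>auto simp: mult.assoc[symmetric] intro!: mult_right_mono\<close>)
    also have "\<dots> \<le> \<bar>C\<bar> * cmod (F x)"
      by (metis abs_Re_le_cmod abs_ge_self abs_mult abs_ge_zero mult_left_mono order_trans)
    finally have "x ^ p \<le> (1 - \<rho> * x) ^ Suc p * (\<bar>C\<bar> * cmod (F x))"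
      using \<rho>x by (simp add: field_simps)
    moreover have "cmod ((1 - of_real (\<rho> * x)) ^ Suc p) = (1 - \<rho> * x) ^ Suc p"
      using \<rho>x by (metis norm_of_real abs_of_pos diff_gt_0_iff_gt norm_power of_real_1 of_real_diff)
    ultimately show ?thesis
      by (simp only: norm_mult mult_ac)
  qed
  have lim_term: "((\<lambda>x. (1 - of_real (\<rho> * x)) ^ Suc p * G b (of_real x)) \<longlongrightarrow> 0) (at_left (1 / \<rho>))"
    if b: "b \<in> B" for b
  proof -
    obtain m \<mu> where [simp]: "b = (m, \<mu>)" by force
    show ?thesis
    proof (cases "\<mu> = of_real \<rho>")
      case False
      \<comment> \<open>\<open>G b\<close> is continuous at \<open>1 / \<rho>\<close>, so the
        vanishing prefactor decides the limit.\<close>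
      have "1 - \<mu> * of_real (1 / \<rho>) \<noteq> 0"
        using False \<rho> by (auto simp: field_simps)
      then have "((\<lambda>x. (1 - of_real (\<rho> * x)) ^ Suc p * G b (of_real x)) \<longlongrightarrow>
          (1 - of_real (\<rho> * (1 / \<rho>))) ^ Suc p * G b (of_real (1 / \<rho>))) (at_left (1 / \<rho>))"
        unfolding G_def \<open>b = (m, \<mu>)\<close> prod.case by (intro tendsto_intros) auto
      then show ?thesis
        using \<rho> by simp
    next
      case True
      \<comment> \<open>By \<open>neg\<close> the pole order \<open>m + 1\<close> is at most
        \<open>p\<close>, so cancelling it leaves the positive power \<open>p - m\<close> of
        \<open>1 - \<rho> * x\<close>. The cancellation needs \<open>\<rho> * x \<noteq> 1\<close>,
        so it is only claimed eventually from the left.\<close>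
      then have "m < p"
        using neg b by (auto simp: not_le[symmetric])
      have "((\<lambda>x. (1 - of_real (\<rho> * x)) ^ (p - m) * of_real x ^ m :: complex) \<longlongrightarrow>
          (1 - of_real (\<rho> * (1 / \<rho>))) ^ (p - m) * of_real (1 / \<rho>) ^ m) (at_left (1 / \<rho>))"
        by (intro tendsto_intros)
      then have "((\<lambda>x. (1 - of_real (\<rho> * x)) ^ (p - m) * of_real x ^ m :: complex) \<longlongrightarrow> 0)
          (at_left (1 / \<rho>))"
        using \<open>m < p\<close> \<rho> by (simp add: power_0_left)
      moreover have "\<forall>\<^sub>F x in at_left (1 / \<rho>). x \<in> {0 <..< 1 / \<rho>}"
        using \<rho> by (intro eventually_at_leftI[of 0]) auto
      then have "\<forall>\<^sub>F x in at_left (1 / \<rho>). (1 - of_real (\<rho> * x)) ^ (p - m) * of_real x ^ m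
          = (1 - of_real (\<rho> * x)) ^ Suc p * G b (of_real x)"
      proof (eventually_elim)
        case (elim x)
        define z where "z = 1 - complex_of_real (\<rho> * x)"
        have "z \<noteq> 0"
          using elim \<rho> by (auto simp: z_def field_simps simp flip: of_real_mult)
        moreover have "z ^ Suc p = z ^ (p - m) * z ^ Suc m"
          using \<open>m < p\<close> by (simp flip: power_add)
        ultimately have "z ^ (p - m) * of_real x ^ m = z ^ Suc p * (of_real x ^ m / z ^ Suc m)"
          by simp
        then show ?case
          by (simp add: G_def True z_def)
      qed
      ultimately show ?thesis
        by (rule Lim_transform_eventually)
    qed
  qed
  have "((\<lambda>x. (1 - of_real (\<rho> * x)) ^ Suc p * F x) \<longlongrightarrow> (\<Sum>b\<in>B. c b * 0)) (at_left (1 / \<rho>))"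
    unfolding F_def sum_distrib_left mult.left_commute[of "_ ^ _" "c _"]
    by (intro tendsto_sum tendsto_mult tendsto_const lim_term)
  then have "((\<lambda>x. \<bar>C\<bar> * cmod ((1 - of_real (\<rho> * x)) ^ Suc p * F x)) \<longlongrightarrow> \<bar>C\<bar> * cmod 0) (at_left (1 / \<rho>))"
    by (intro tendsto_intros) simp
  moreover have "((\<lambda>x. x ^ p) \<longlongrightarrow> (1 / \<rho>) ^ p) (at_left (1 / \<rho>))"
    by (intro tendsto_intros)
  moreover have "\<forall>\<^sub>F x in at_left (1 / \<rho>).
      x ^ p \<le> \<bar>C\<bar> * cmod ((1 - of_real (\<rho> * x)) ^ Suc p * F x)"
    using \<rho> ineq by (intro eventually_at_leftI[of 0]) auto
  \<comment> \<open>Passing to the limit in \<open>ineq\<close> bounds a positive number by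
    zero.\<close>
  ultimately have "(1 / \<rho>) ^ p \<le> \<bar>C\<bar> * cmod 0"
    by (intro tendsto_le[of "at_left (1 / \<rho>)"]) auto
  moreover have "(1 / \<rho>) ^ p > 0"
    using \<rho> by simp
  ultimately show False
    by simp
qed

section \<open>Linear combinations of exponential polynomials\<close>

text \<open>For infinite \<open>B\<close> the sum is zero by convention; this is why
  \<open>exp_poly_span_base\<close> asks for finiteness.\<close>

definition exp_poly_span :: "(nat \<times> complex) set \<Rightarrow> (nat \<Rightarrow> complex) set" where
  "exp_poly_span B = {f. \<exists>c. \<forall>k. f k = (\<Sum>b\<in>B. c b * exp_poly b k)}"

lemma exp_poly_span_zero: "(\<lambda>k. 0) \<in> exp_poly_span B"
  unfolding exp_poly_span_def by (auto intro!: exI[of _ "\<lambda>_. 0"])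

lemma exp_poly_span_base: "finite B \<Longrightarrow> b \<in> B \<Longrightarrow> exp_poly b \<in> exp_poly_span B"
  unfolding exp_poly_span_def
  by (auto intro!: exI[of _ "\<lambda>b'. if b' = b then 1 else 0"] simp: if_distrib[of "\<lambda>t. t * _"] cong: if_cong)

lemma exp_poly_span_mult:
  "f \<in> exp_poly_span B \<Longrightarrow> (\<lambda>k. a * f k) \<in> exp_poly_span B"
  unfolding exp_poly_span_def
  by (auto simp: sum_distrib_left mult.assoc[symmetric])

lemma exp_poly_span_add:
  assumes "f \<in> exp_poly_span B" "g \<in> exp_poly_span B"
  shows "(\<lambda>k. f k + g k) \<in> exp_poly_span B"
proof -
  obtain c d where "\<And>k. f k = (\<Sum>b\<in>B. c b * exp_poly b k)" "\<And>k. g k = (\<Sum>b\<in>B. d b * exp_poly b k)"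
    using assms unfolding exp_poly_span_def by blast
  then have "\<forall>k. f k + g k = (\<Sum>b\<in>B. (c b + d b) * exp_poly b k)"
    by (simp add: sum.distrib distrib_right)
  then show ?thesis
    unfolding exp_poly_span_def by (intro CollectI exI)
qed

lemma exp_poly_span_sum:
  assumes "\<And>i. i \<in> I \<Longrightarrow> f i \<in> exp_poly_span B"
  shows "(\<lambda>k. \<Sum>i\<in>I. f i k) \<in> exp_poly_span B"
  using assms
  by (induction I rule: infinite_finite_induct) (auto intro: exp_poly_span_zero exp_poly_span_add)

section \<open>Powers of matrices in Jordan normal form\<close>

text \<open>Membership of \<open>(m, \<mu>)\<close> says that some block for \<open>\<mu>\<close>
  has size at least \<open>m + 1\<close>, which turns statements about block sizes into statements
  about modes.\<close>

definition jordan_modes :: "(nat \<times> complex) list \<Rightarrow> (nat \<times> complex) set" where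
  "jordan_modes n_as = {(m, \<mu>). \<exists>s. (s, \<mu>) \<in> set n_as \<and> m < s}"

lemma finite_jordan_modes: "finite (jordan_modes n_as)"
proof -
  have "jordan_modes n_as = (\<Union>(s, \<mu>)\<in>set n_as. {..<s} \<times> {\<mu>})"
    by (force simp: jordan_modes_def)
  then show ?thesis by auto
qed

lemma jordan_block_pow_exp_poly:
  assumes "i < s" "j < s"
  shows "(jordan_block s \<mu> ^\<^sub>m k) $$ (i, j) = (if i \<le> j then exp_poly (j - i, \<mu>) k else 0)"
  using assms by (auto simp: jordan_block_pow exp_poly_def)

text \<open>Powers of a block diagonal matrix are taken blockwise; this form lets inductions peel
  off the leading block.\<close>

lemma jordan_matrix_Cons_pow_index:
  assumes "i < s + sum_list (map fst n_as)" "j < s + sum_list (map fst n_as)"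
  shows "(jordan_matrix ((s, \<mu>) # n_as) ^\<^sub>m k) $$ (i, j) =
    (if i < s \<and> j < s then (jordan_block s \<mu> ^\<^sub>m k) $$ (i, j)
     else if s \<le> i \<and> s \<le> j then (jordan_matrix n_as ^\<^sub>m k) $$ (i - s, j - s) else 0)"
proof -
  have dim: "dim_row (jordan_matrix n_as ^\<^sub>m k) = sum_list (map fst n_as)"
    "dim_col (jordan_matrix n_as ^\<^sub>m k) = sum_list (map fst n_as)"
    using pow_carrier_mat[OF jordan_matrix_carrier[of n_as], of k] by auto
  have "jordan_matrix ((s, \<mu>) # n_as) ^\<^sub>m k = four_block_mat (jordan_block s \<mu> ^\<^sub>m k)
      (0\<^sub>m s (sum_list (map fst n_as))) (0\<^sub>m (sum_list (map fst n_as)) s) (jordan_matrix n_as ^\<^sub>m k)"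
    using dim unfolding jordan_matrix_pow by (simp add: Let_def)
  then show ?thesis
    using assms dim by auto
qed

lemma jordan_matrix_pow_entry_in_span:
  assumes "i < sum_list (map fst n_as)" "j < sum_list (map fst n_as)"
  shows "(\<lambda>k. (jordan_matrix n_as ^\<^sub>m k) $$ (i, j)) \<in> exp_poly_span (jordan_modes n_as)"
proof -
  \<comment> \<open>The induction proves more than membership in the span: each entry is identically
    zero or a single mode.\<close>
  have "(\<forall>k. (jordan_matrix n_as ^\<^sub>m k) $$ (i, j) = 0) \<or>
      (\<exists>b\<in>jordan_modes n_as. \<forall>k. (jordan_matrix n_as ^\<^sub>m k) $$ (i, j) = exp_poly b k)"
    using assms
  proof (induction n_as arbitrary: i j)
    case (Cons sa n_as)
    obtain s \<mu> where [simp]: "sa = (s, \<mu>)" by force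
    have sub: "jordan_modes n_as \<subseteq> jordan_modes (sa # n_as)"
      by (auto simp: jordan_modes_def)
    consider "i < s" "j < s" | "s \<le> i" "s \<le> j" | "\<not> (i < s \<and> j < s)" "\<not> (s \<le> i \<and> s \<le> j)"
      by linarith
    then show ?case
    proof cases
      case 1
      have "(j - i, \<mu>) \<in> jordan_modes (sa # n_as)"
        using 1 by (auto simp: jordan_modes_def)
      then show ?thesis
        using 1 Cons.prems jordan_block_pow_exp_poly[OF 1, of \<mu>]
        by (cases "i \<le> j") (auto simp: jordan_matrix_Cons_pow_index)
    next
      case 2
      have "i - s < sum_list (map fst n_as)" "j - s < sum_list (map fst n_as)"
        using 2 Cons.prems by auto
      from Cons.IH[OF this] show ?thesis
        using 2 Cons.prems sub by (auto simp: jordan_matrix_Cons_pow_index)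
    next
      case 3
      then show ?thesis
        using Cons.prems by (auto simp: jordan_matrix_Cons_pow_index)
    qed
  qed simp
  then show ?thesis
  proof
    assume "\<forall>k. (jordan_matrix n_as ^\<^sub>m k) $$ (i, j) = 0"
    then show ?thesis by (simp add: exp_poly_span_zero)
  next
    assume "\<exists>b\<in>jordan_modes n_as. \<forall>k. (jordan_matrix n_as ^\<^sub>m k) $$ (i, j) = exp_poly b k"
    then obtain b where "b \<in> jordan_modes n_as"
      "(\<lambda>k. (jordan_matrix n_as ^\<^sub>m k) $$ (i, j)) = exp_poly b" by auto
    then show ?thesis
      by (simp add: exp_poly_span_base finite_jordan_modes)
  qed
qed

text \<open>The mode sits in the top right corner of the block; the offsets of preceding blocks are
  added along the induction.\<close>

lemma jordan_matrix_pow_top_mode: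
  assumes "(Suc m, \<mu>) \<in> set n_as"
  obtains i j where "i < sum_list (map fst n_as)" "j < sum_list (map fst n_as)"
    "\<And>k. (jordan_matrix n_as ^\<^sub>m k) $$ (i, j) = exp_poly (m, \<mu>) k"
  using assms
proof (induction n_as arbitrary: thesis)
  case (Cons sa n_as)
  obtain s \<nu> where [simp]: "sa = (s, \<nu>)" by force
  show ?case
  proof (cases "(Suc m, \<mu>) \<in> set n_as")
    case True
    then obtain i j where ij: "i < sum_list (map fst n_as)" "j < sum_list (map fst n_as)"
      "\<And>k. (jordan_matrix n_as ^\<^sub>m k) $$ (i, j) = exp_poly (m, \<mu>) k"
      using Cons.IH by blast
    show ?thesis
      by (rule Cons.prems(1)[of "i + s" "j + s"]) (use ij in \<open>auto simp: jordan_matrix_Cons_pow_index\<close>)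
  next
    case False
    then have "s = Suc m" "\<nu> = \<mu>"
      using Cons.prems(2) by auto
    then show ?thesis
      by (intro Cons.prems(1)[of 0 m])
        (auto simp: jordan_matrix_Cons_pow_index jordan_block_pow_exp_poly)
  qed
qed simp

lemma mult3_mat_index:
  assumes "P \<in> carrier_mat n n" "M \<in> carrier_mat n n" "Q \<in> carrier_mat n n" "i < n" "j < n"
  shows "(P * M * Q) $$ (i, j) = (\<Sum>q<n. \<Sum>p<n. P $$ (i, p) * M $$ (p, q) * Q $$ (q, j))"
proof -
  have "(P * M * Q) $$ (i, j) = (\<Sum>q<n. (P * M) $$ (i, q) * Q $$ (q, j))"
    using assms by (simp add: scalar_prod_def atLeast0LessThan del: assoc_mult_mat)
  also have "\<dots> = (\<Sum>q<n. \<Sum>p<n. P $$ (i, p) * M $$ (p, q) * Q $$ (q, j))"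
    using assms by (intro sum.cong refl) (simp add: scalar_prod_def sum_distrib_right atLeast0LessThan)
  finally show ?thesis .
qed

text \<open>Conjugation by fixed matrices makes each entry of \<open>A ^\<^sub>m k\<close> a
  combination of entries of the Jordan powers, with coefficients independent of
  \<open>k\<close>.\<close>

lemma jordan_nf_pow_entry_in_span:
  assumes A: "A \<in> carrier_mat n n" and jnf: "jordan_nf A n_as" and ij: "i < n" "j < n"
  shows "(\<lambda>k. (A ^\<^sub>m k) $$ (i, j)) \<in> exp_poly_span (jordan_modes n_as)"
proof -
  obtain P Q where wit: "similar_mat_wit A (jordan_matrix n_as) P Q"
    using jnf unfolding jordan_nf_def similar_mat_def by blast
  have J: "jordan_matrix n_as \<in> carrier_mat n n" and P: "P \<in> carrier_mat n n" and Q: "Q \<in> carrier_mat n n"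
    using similar_mat_witD2[OF A wit] by auto
  have n: "n = sum_list (map fst n_as)"
    using J by auto
  have "(\<lambda>k. (A ^\<^sub>m k) $$ (i, j)) =
      (\<lambda>k. \<Sum>q<n. \<Sum>p<n. (P $$ (i, p) * Q $$ (q, j)) * (jordan_matrix n_as ^\<^sub>m k) $$ (p, q))"
    using similar_mat_wit_pow_id[OF wit] mult3_mat_index[OF P pow_carrier_mat[OF J] Q ij]
    by (simp add: mult_ac)
  also have "\<dots> \<in> exp_poly_span (jordan_modes n_as)"
    by (intro exp_poly_span_sum exp_poly_span_mult jordan_matrix_pow_entry_in_span) (auto simp: n)
  finally show ?thesis .
qed

lemma jordan_nf_eigenvalue_iff:
  assumes A: "(A :: complex mat) \<in> carrier_mat n n" and jnf: "jordan_nf A n_as"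
  shows "eigenvalue A \<mu> \<longleftrightarrow> (\<exists>s. (s, \<mu>) \<in> set n_as)"
proof -
  \<comment> \<open>A block of size zero would contribute a constant factor without a root.\<close>
  have "s \<noteq> 0" if "(s, \<nu>) \<in> set n_as" for s \<nu>
    using jnf that unfolding jordan_nf_def by force
  then show ?thesis
    unfolding eigenvalue_root_char_poly[OF A] jordan_nf_char_poly[OF jnf]
    by (force simp: poly_prod_list prod_list_zero_iff o_def)
qed

text \<open>Conjugating back, the corner entry of the block of size \<open>t\<close> is a fixed
  combination of entries of \<open>A ^\<^sub>m k\<close>, hence at most a constant times
  \<open>s k\<close>. \<open>exp_poly_dominated_imp_mem\<close> then applies with
  \<open>\<rho> = cmod \<mu>\<close> and \<open>p = t - 1\<close>.\<close>

lemma dominated_powers_imp_large_block: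
  assumes A: "A \<in> carrier_mat n n" and jnf: "jordan_nf A n_as"
    and s: "(\<lambda>k. of_real (s k)) \<in> exp_poly_span (jordan_modes n_as)"
    and dom: "\<And>i j k. i < n \<Longrightarrow> j < n \<Longrightarrow> cmod ((A ^\<^sub>m k) $$ (i, j)) \<le> s k"
    and max: "\<And>t \<nu>. (t, \<nu>) \<in> set n_as \<Longrightarrow> cmod \<nu> \<le> cmod \<mu>"
    and \<mu>: "(t, \<mu>) \<in> set n_as" "\<mu> \<noteq> 0"
  shows "\<exists>t'\<ge>t. (t', of_real (cmod \<mu>)) \<in> set n_as"
proof -
  have "t \<noteq> 0"
    using jnf \<mu>(1) unfolding jordan_nf_def by force
  then obtain m where m: "t = Suc m"
    using not0_implies_Suc by blast
  obtain P Q where wit: "similar_mat_wit (jordan_matrix n_as) A P Q"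
    using jnf unfolding jordan_nf_def using similar_mat_sym similar_mat_def by blast
  have P: "P \<in> carrier_mat n n" and Q: "Q \<in> carrier_mat n n" and J: "jordan_matrix n_as \<in> carrier_mat n n"
    using wit A unfolding similar_mat_wit_def Let_def by auto
  have n: "n = sum_list (map fst n_as)"
    using J by auto
  obtain i j where ij: "i < n" "j < n"
    "\<And>k. (jordan_matrix n_as ^\<^sub>m k) $$ (i, j) = exp_poly (m, \<mu>) k"
    using jordan_matrix_pow_top_mode \<mu>(1) unfolding m n by metis
  define C where "C = (\<Sum>q<n. \<Sum>p<n. cmod (P $$ (i, p)) * cmod (Q $$ (q, j)))"
  have "real (k choose m) * cmod \<mu> ^ (k - m) \<le> C * s k" for k
  proof -
    have "real (k choose m) * cmod \<mu> ^ (k - m) = cmod ((jordan_matrix n_as ^\<^sub>m k) $$ (i, j))"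
      by (simp add: ij exp_poly_def norm_mult norm_power)
    also have "\<dots> = cmod (\<Sum>q<n. \<Sum>p<n. P $$ (i, p) * (A ^\<^sub>m k) $$ (p, q) * Q $$ (q, j))"
      using similar_mat_wit_pow_id[OF wit, of k] mult3_mat_index[OF P pow_carrier_mat[OF A] Q ij(1,2)]
      by simp
    also have "\<dots> \<le> (\<Sum>q<n. \<Sum>p<n. cmod (P $$ (i, p) * (A ^\<^sub>m k) $$ (p, q) * Q $$ (q, j)))"
      by (intro order_trans[OF norm_sum] sum_mono order_refl)
    also have "\<dots> \<le> (\<Sum>q<n. \<Sum>p<n. cmod (P $$ (i, p)) * s k * cmod (Q $$ (q, j)))"
      unfolding norm_mult by (intro sum_mono mult_right_mono mult_left_mono dom) auto
    also have "\<dots> = C * s k"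
      unfolding C_def sum_distrib_right by (simp add: mult_ac)
    finally show ?thesis .
  qed
  moreover obtain c where "\<And>k. of_real (s k) = (\<Sum>b\<in>jordan_modes n_as. c b * exp_poly b k)"
    using s unfolding exp_poly_span_def by blast
  moreover have "\<And>m \<nu>. (m, \<nu>) \<in> jordan_modes n_as \<Longrightarrow> cmod \<nu> \<le> cmod \<mu>"
    using max by (auto simp: jordan_modes_def)
  ultimately have "\<exists>m'\<ge>m. (m', of_real (cmod \<mu>)) \<in> jordan_modes n_as"
    using \<mu>(2) by (intro exp_poly_dominated_imp_mem[OF finite_jordan_modes]) auto
  then show ?thesis
    \<comment> \<open>A mode with index \<open>m' \<ge> m\<close> lies in a block of size above
      \<open>m'\<close>, hence of size at least \<open>Suc m = t\<close>.\<close>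
    by (auto simp: jordan_modes_def m) (meson Suc_leI le_less_trans)
qed

section \<open>Sums of Kronecker products of a conjugate matrix with the matrix itself\<close>

text \<open>Under column stacking these are the matrices of completely positive maps, with
  \<open>Ys\<close> as Kraus operators. The entrywise form encodes an index \<open>i\<close> as the
  pair \<open>(i div n, i mod n)\<close>; the empty list gives the zero matrix.\<close>

definition conj_kron_sum :: "nat \<Rightarrow> complex mat \<Rightarrow> bool" where
  "conj_kron_sum n M \<longleftrightarrow> M \<in> carrier_mat (n * n) (n * n) \<and>
    (\<exists>Ys. set Ys \<subseteq> carrier_mat n n \<and>
      (\<forall>i<n * n. \<forall>j<n * n. M $$ (i, j) =
        (\<Sum>Y\<leftarrow>Ys. cnj (Y $$ (i div n, j div n)) * Y $$ (i mod n, j mod n))))"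

lemma conj_kron_sumE:
  assumes "conj_kron_sum n M"
  obtains Ys where "set Ys \<subseteq> carrier_mat n n"
    "\<And>i j. i < n * n \<Longrightarrow> j < n * n \<Longrightarrow> M $$ (i, j) =
      (\<Sum>Y\<leftarrow>Ys. cnj (Y $$ (i div n, j div n)) * Y $$ (i mod n, j mod n))"
  using assms unfolding conj_kron_sum_def by blast

lemma div_mod_less_square:
  assumes "i < n * (n :: nat)"
  shows "i div n < n" "i mod n < n"
  using assms by (cases n; simp add: less_mult_imp_div_less)+

lemma mult_add_less_square:
  assumes "p < n" "q < (n :: nat)"
  shows "p * n + q < n * n"
  using mult_le_mono1[of "Suc p" n n] assms by simp

lemma sum_div_mod:
  fixes f :: "nat \<Rightarrow> nat \<Rightarrow> 'a :: comm_monoid_add"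
  shows "(\<Sum>l<n * n. f (l div n) (l mod n)) = (\<Sum>p<n. \<Sum>q<n. f p q)"
proof -
  have "(\<Sum>l<n * n. f (l div n) (l mod n)) = (\<Sum>(p, q)\<in>{..<n} \<times> {..<n}. f p q)"
    by (rule sum.reindex_bij_witness[of _ "\<lambda>(p, q). p * n + q" "\<lambda>l. (l div n, l mod n)"])
      (auto simp: div_mod_less_square mult_add_less_square)
  then show ?thesis by (simp add: sum.cartesian_product)
qed

lemma conj_kron_sum_zero: "conj_kron_sum n (0\<^sub>m (n * n) (n * n))"
  unfolding conj_kron_sum_def by (auto intro!: exI[of _ "[]"])

lemma conj_kron_sum_one: "conj_kron_sum n (1\<^sub>m (n * n))"
proof -
  have "1\<^sub>m (n * n) $$ (i, j) =
      (\<Sum>Y\<leftarrow>[1\<^sub>m n]. cnj (Y $$ (i div n, j div n)) * Y $$ (i mod n, j mod n))"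
    if "i < n * n" "j < n * n" for i j
  proof (cases "i div n = j div n \<and> i mod n = j mod n")
    case True
    then have "i = j"
      by (metis div_mult_mod_eq)
    then show ?thesis
      using that by (simp add: div_mod_less_square)
  next
    case False
    then have "i \<noteq> j"
      by blast
    then show ?thesis
      using that False div_mod_less_square[OF that(1)] div_mod_less_square[OF that(2)] by auto
  qed
  then show ?thesis
    unfolding conj_kron_sum_def by (intro conjI exI[of _ "[1\<^sub>m n]"]) simp_all
qed

lemma conj_kron_sum_kronecker:
  "Y \<in> carrier_mat n n \<Longrightarrow> conj_kron_sum n (map_mat cnj Y \<otimes>\<^sub>K Y)"
  unfolding conj_kron_sum_def kronecker_def
  by (auto intro!: exI[of _ "[Y]"] simp: div_mod_less_square)

lemma conj_kron_sum_add:
  assumes "conj_kron_sum n M" "conj_kron_sum n N"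
  shows "conj_kron_sum n (M + N)"
proof -
  from assms(1) obtain Ys where Ys: "set Ys \<subseteq> carrier_mat n n"
    and M: "\<And>i j. i < n * n \<Longrightarrow> j < n * n \<Longrightarrow> M $$ (i, j) =
      (\<Sum>Y\<leftarrow>Ys. cnj (Y $$ (i div n, j div n)) * Y $$ (i mod n, j mod n))"
    by (rule conj_kron_sumE) blast
  from assms(2) obtain Zs where Zs: "set Zs \<subseteq> carrier_mat n n"
    and N: "\<And>i j. i < n * n \<Longrightarrow> j < n * n \<Longrightarrow> N $$ (i, j) =
      (\<Sum>Y\<leftarrow>Zs. cnj (Y $$ (i div n, j div n)) * Y $$ (i mod n, j mod n))"
    by (rule conj_kron_sumE) blast
  have "M \<in> carrier_mat (n * n) (n * n)" "N \<in> carrier_mat (n * n) (n * n)"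
    using assms by (auto simp: conj_kron_sum_def)
  then show ?thesis
    unfolding conj_kron_sum_def
    by (intro conjI exI[of _ "Ys @ Zs"]) (use Ys Zs M N in auto)
qed

lemma sum_list_product:
  fixes f :: "'a \<Rightarrow> 'c :: semiring_0"
  shows "(\<Sum>x\<leftarrow>xs. f x) * (\<Sum>y\<leftarrow>ys. g y) = (\<Sum>(x, y)\<leftarrow>List.product xs ys. f x * g y)"
  by (induction xs) (auto simp: distrib_right sum_list_const_mult o_def)

lemma sum_sum_list_swap:
  fixes f :: "'a \<Rightarrow> 'b \<Rightarrow> 'c :: comm_monoid_add"
  shows "(\<Sum>i\<in>I. \<Sum>x\<leftarrow>xs. f i x) = (\<Sum>x\<leftarrow>xs. \<Sum>i\<in>I. f i x)"
  by (induction xs) (auto simp: sum.distrib)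

lemma norm_sum_list_le:
  fixes f :: "'a \<Rightarrow> 'b :: real_normed_vector"
  shows "norm (\<Sum>x\<leftarrow>xs. f x) \<le> (\<Sum>x\<leftarrow>xs. norm (f x))"
  by (induction xs) (auto intro: norm_triangle_le)

text \<open>By the mixed product rule, the product of the terms for \<open>Y\<close> and
  \<open>Z\<close> is the term for \<open>Y * Z\<close>, so all pairwise products serve as the new
  list.\<close>

lemma conj_kron_sum_mult:
  assumes "conj_kron_sum n M" "conj_kron_sum n N"
  shows "conj_kron_sum n (M * N)"
proof -
  from assms(1) obtain Ys where Ys: "set Ys \<subseteq> carrier_mat n n"
    and M: "\<And>i j. i < n * n \<Longrightarrow> j < n * n \<Longrightarrow> M $$ (i, j) =
      (\<Sum>Y\<leftarrow>Ys. cnj (Y $$ (i div n, j div n)) * Y $$ (i mod n, j mod n))"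
    by (rule conj_kron_sumE) blast
  from assms(2) obtain Zs where Zs: "set Zs \<subseteq> carrier_mat n n"
    and N: "\<And>i j. i < n * n \<Longrightarrow> j < n * n \<Longrightarrow> N $$ (i, j) =
      (\<Sum>Y\<leftarrow>Zs. cnj (Y $$ (i div n, j div n)) * Y $$ (i mod n, j mod n))"
    by (rule conj_kron_sumE) blast
  have dim: "M \<in> carrier_mat (n * n) (n * n)" "N \<in> carrier_mat (n * n) (n * n)"
    using assms by (auto simp: conj_kron_sum_def)
  define Ws where "Ws = map (\<lambda>(Y, Z). Y * Z) (List.product Ys Zs)"
  have "(M * N) $$ (i, j) = (\<Sum>W\<leftarrow>Ws. cnj (W $$ (i div n, j div n)) * W $$ (i mod n, j mod n))"
    if ij: "i < n * n" "j < n * n" for i j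
  proof -
    note lt = div_mod_less_square[OF ij(1)] div_mod_less_square[OF ij(2)]
    have "(M * N) $$ (i, j) = (\<Sum>l<n * n. M $$ (i, l) * N $$ (l, j))"
      using dim ij by (simp add: scalar_prod_def atLeast0LessThan)
    also have "\<dots> = (\<Sum>l<n * n. \<Sum>(Y, Z)\<leftarrow>List.product Ys Zs.
        cnj (Y $$ (i div n, l div n)) * Y $$ (i mod n, l mod n) *
        (cnj (Z $$ (l div n, j div n)) * Z $$ (l mod n, j mod n)))"
      using ij by (simp add: M N sum_list_product)
    also have "\<dots> = (\<Sum>(Y, Z)\<leftarrow>List.product Ys Zs. \<Sum>l<n * n.
        cnj (Y $$ (i div n, l div n)) * Y $$ (i mod n, l mod n) *
        (cnj (Z $$ (l div n, j div n)) * Z $$ (l mod n, j mod n)))"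
      unfolding sum_sum_list_swap by (simp add: case_prod_unfold)
    also have "\<dots> = (\<Sum>(Y, Z)\<leftarrow>List.product Ys Zs.
        cnj ((Y * Z) $$ (i div n, j div n)) * (Y * Z) $$ (i mod n, j mod n))"
    proof (intro arg_cong[of _ _ sum_list] map_cong refl, clarsimp)
      fix Y Z assume "Y \<in> set Ys" "Z \<in> set Zs"
      then have YZ: "Y \<in> carrier_mat n n" "Z \<in> carrier_mat n n"
        using Ys Zs by auto
      \<comment> \<open>Splitting \<open>l\<close> into quotient and remainder factors the sum:
        quotients give the conjugated entry of \<open>Y * Z\<close>, remainders the plain
        one.\<close>
      have "(\<Sum>l<n * n. cnj (Y $$ (i div n, l div n)) * Y $$ (i mod n, l mod n) *
            (cnj (Z $$ (l div n, j div n)) * Z $$ (l mod n, j mod n)))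
          = (\<Sum>p<n. \<Sum>q<n. cnj (Y $$ (i div n, p)) * Y $$ (i mod n, q) *
            (cnj (Z $$ (p, j div n)) * Z $$ (q, j mod n)))"
        by (rule sum_div_mod)
      also have "\<dots> = (\<Sum>p<n. cnj (Y $$ (i div n, p) * Z $$ (p, j div n))) *
          (\<Sum>q<n. Y $$ (i mod n, q) * Z $$ (q, j mod n))"
        unfolding sum_product by (simp add: mult_ac)
      also have "\<dots> = cnj ((Y * Z) $$ (i div n, j div n)) * (Y * Z) $$ (i mod n, j mod n)"
        using YZ lt by (simp add: scalar_prod_def atLeast0LessThan)
      finally show "(\<Sum>l<n * n. cnj (Y $$ (i div n, l div n)) * Y $$ (i mod n, l mod n) *
            (cnj (Z $$ (l div n, j div n)) * Z $$ (l mod n, j mod n)))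
          = cnj ((Y * Z) $$ (i div n, j div n)) * (Y * Z) $$ (i mod n, j mod n)" .
    qed
    also have "\<dots> = (\<Sum>W\<leftarrow>Ws. cnj (W $$ (i div n, j div n)) * W $$ (i mod n, j mod n))"
      by (simp add: Ws_def o_def case_prod_unfold)
    finally show ?thesis .
  qed
  moreover have "set Ws \<subseteq> carrier_mat n n"
    using Ys Zs unfolding Ws_def by (auto 4 3 intro!: mult_carrier_mat)
  ultimately show ?thesis
    unfolding conj_kron_sum_def using mult_carrier_mat[OF dim] by blast
qed

lemma conj_kron_sum_pow: "conj_kron_sum n M \<Longrightarrow> conj_kron_sum n (M ^\<^sub>m k)"
proof (induction k)
  case 0
  then have "dim_row M = n * n"
    by (auto simp: conj_kron_sum_def)
  then show ?case
    by (simp add: conj_kron_sum_one)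
qed (simp add: conj_kron_sum_mult)

lemma conj_kron_sum_finsum:
  assumes "finite I" "\<And>i. i \<in> I \<Longrightarrow> conj_kron_sum n (M i)"
  shows "conj_kron_sum n (finsum (ring_mat TYPE(complex) (n * n) b) M I)"
proof -
  interpret R: ring "ring_mat TYPE(complex) (n * n) b"
    by (rule ring_mat)
  show ?thesis
    using assms
  proof (induction I rule: finite_induct)
    case empty
    then show ?case
      using conj_kron_sum_zero by (simp add: ring_mat_simps)
  next
    case (insert i I)
    have carr: "M ` insert i I \<subseteq> carrier (ring_mat TYPE(complex) (n * n) b)"
      using insert.prems by (auto simp: conj_kron_sum_def ring_mat_simps)
    have "finsum (ring_mat TYPE(complex) (n * n) b) M (insert i I)
        = M i + finsum (ring_mat TYPE(complex) (n * n) b) M I"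
      using R.finsum_insert[OF insert.hyps, of M] carr by (auto simp: ring_mat_simps)
    then show ?case
      using insert by (simp add: conj_kron_sum_add)
  qed
qed

text \<open>The entry of \<open>cnj Y \<otimes> Y\<close> at \<open>(p * n + p, q * n + q)\<close> is the squared modulus of \<open>Y $$ (p, q)\<close>.\<close>

lemma conj_kron_sum_entry_bound:
  assumes M: "conj_kron_sum n M" and ij: "i < n * n" "j < n * n"
  defines "S \<equiv> \<Sum>p<n. \<Sum>q<n. M $$ (p * n + p, q * n + q)"
  shows "S \<in> \<real>" "cmod (M $$ (i, j)) \<le> Re S"
proof -
  from M obtain Ys where M: "\<And>i j. i < n * n \<Longrightarrow> j < n * n \<Longrightarrow> M $$ (i, j) =
      (\<Sum>Y\<leftarrow>Ys. cnj (Y $$ (i div n, j div n)) * Y $$ (i mod n, j mod n))"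
    by (rule conj_kron_sumE) blast
  \<comment> \<open>The squared Frobenius norm, which bounds the squared modulus of every
    entry.\<close>
  define F where "F = (\<lambda>Y :: complex mat. \<Sum>p<n. \<Sum>q<n. (cmod (Y $$ (p, q)))\<^sup>2)"
  have F: "(cmod (Y $$ (p, q)))\<^sup>2 \<le> F Y" if "p < n" "q < n" for Y p q
  proof -
    have "(cmod (Y $$ (p, q)))\<^sup>2 \<le> (\<Sum>q<n. (cmod (Y $$ (p, q)))\<^sup>2)"
      using that by (intro member_le_sum) auto
    also have "\<dots> \<le> F Y"
      unfolding F_def using that by (intro member_le_sum) (auto intro: sum_nonneg)
    finally show ?thesis .
  qed
  have "S = (\<Sum>p<n. \<Sum>q<n. \<Sum>Y\<leftarrow>Ys. of_real ((cmod (Y $$ (p, q)))\<^sup>2))"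
    unfolding S_def
    by (intro sum.cong refl) (simp add: M mult_add_less_square complex_norm_square mult.commute del: of_real_power)
  also have "\<dots> = (\<Sum>Y\<leftarrow>Ys. of_real (F Y))"
    unfolding sum_sum_list_swap F_def by simp
  also have "\<dots> = of_real (\<Sum>Y\<leftarrow>Ys. F Y)"
    by (induction Ys) auto
  finally have S: "S = of_real (\<Sum>Y\<leftarrow>Ys. F Y)" .
  then show "S \<in> \<real>" by simp
  have "cmod (M $$ (i, j)) \<le> (\<Sum>Y\<leftarrow>Ys. cmod (cnj (Y $$ (i div n, j div n)) * Y $$ (i mod n, j mod n)))"
    unfolding M[OF ij] by (rule norm_sum_list_le)
  also have "\<dots> \<le> (\<Sum>Y\<leftarrow>Ys. F Y)"
  proof (rule sum_list_mono)
    fix Y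
    define a b where "a = cmod (Y $$ (i div n, j div n))" and "b = cmod (Y $$ (i mod n, j mod n))"
    have "a\<^sup>2 \<le> F Y" "b\<^sup>2 \<le> F Y"
      unfolding a_def b_def using div_mod_less_square[OF ij(1)] div_mod_less_square[OF ij(2)] F by auto
    \<comment> \<open>The product of the two moduli is at most the mean of their squares, and each
      square is at most \<open>F Y\<close>.\<close>
    moreover have "2 * a * b \<le> a\<^sup>2 + b\<^sup>2"
      by (rule sum_squares_bound)
    ultimately show "cmod (cnj (Y $$ (i div n, j div n)) * Y $$ (i mod n, j mod n)) \<le> F Y"
      by (simp add: norm_mult a_def b_def)
  qed
  finally show "cmod (M $$ (i, j)) \<le> Re S"
    by (simp add: S)
qed

section \<open>The spectral radius as an eigenvalue of largest degeneracy index\<close>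

text \<open>The class is closed under powers, so the functional of
  \<open>conj_kron_sum_entry_bound\<close> applied to \<open>T ^\<^sub>m k\<close> gives a real
  sequence \<open>S\<close> that dominates all entries and, being linear in the power, lies in the
  span of the Jordan modes.\<close>

theorem conj_kron_sum_dominant_eigenvalue:
  assumes n: "n \<ge> 1" and T: "conj_kron_sum n T"
  defines "\<rho> \<equiv> spectral_radius T"
  shows "eigenvalue T (of_real \<rho>)"
    and "eigenvalue T \<nu> \<Longrightarrow> cmod \<nu> = \<rho> \<Longrightarrow> degeneracy_index T \<nu> \<le> degeneracy_index T (of_real \<rho>)"
proof -
  have carr: "T \<in> carrier_mat (n * n) (n * n)"
    using T by (simp add: conj_kron_sum_def)
  have n2: "n * n > 0"
    using n by simp
  obtain n_as where jnf: "jordan_nf T n_as"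
    using char_poly_factorized[OF carr] jordan_nf_exists[OF carr] by blast
  note ev_iff = jordan_nf_eigenvalue_iff[OF carr jnf]
  have max: "cmod \<nu> \<le> \<rho>" if "(t, \<nu>) \<in> set n_as" for t \<nu>
    using spectral_radius_mem_max(2)[OF carr n2, of "cmod \<nu>"] that ev_iff[of \<nu>]
    unfolding \<rho>_def spectrum_def by blast
  define S where "S = (\<lambda>k. \<Sum>p<n. \<Sum>q<n. (T ^\<^sub>m k) $$ (p * n + p, q * n + q))"
  have bound: "S k \<in> \<real>" "cmod ((T ^\<^sub>m k) $$ (i, j)) \<le> Re (S k)"
    if "i < n * n" "j < n * n" for i j k
    unfolding S_def using conj_kron_sum_entry_bound[OF conj_kron_sum_pow[OF T] that] by auto
  have "S \<in> exp_poly_span (jordan_modes n_as)"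
    unfolding S_def
    by (intro exp_poly_span_sum jordan_nf_pow_entry_in_span[OF carr jnf]) (auto intro: mult_add_less_square)
  moreover have "S = (\<lambda>k. of_real (Re (S k)))"
    using bound(1)[OF n2 n2] by (auto simp: fun_eq_iff of_real_Re)
  ultimately have span: "(\<lambda>k. of_real (Re (S k))) \<in> exp_poly_span (jordan_modes n_as)"
    by simp
  have large: "\<exists>t'\<ge>t. (t', of_real \<rho>) \<in> set n_as" if "(t, \<nu>) \<in> set n_as" "cmod \<nu> = \<rho>" for t \<nu>
  \<comment> \<open>The domination argument needs a nonzero eigenvalue. If \<open>\<nu> = 0\<close>
    then \<open>\<rho> = 0\<close>, and the block for \<open>\<nu>\<close> is already one for
    \<open>\<rho>\<close>.\<close>
  proof (cases "\<nu> = 0")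
    case True
    then show ?thesis using that by auto
  next
    case False
    show ?thesis
      using dominated_powers_imp_large_block[OF carr jnf span _ _ that(1) False] bound(2) max that(2)
      by auto
  qed
  \<comment> \<open>The spectral radius is attained in modulus by some eigenvalue, whose block
    forces one for \<open>\<rho>\<close> itself.\<close>
  obtain \<nu>0 where "eigenvalue T \<nu>0" "cmod \<nu>0 = \<rho>"
    using spectral_radius_mem_max(1)[OF carr n2] unfolding \<rho>_def spectrum_def by auto
  then show "eigenvalue T (of_real \<rho>)"
    using large ev_iff by blast
  have fin: "finite {k. (k, \<nu>) \<in> set n_as}" for \<nu>
    by (rule finite_subset[of _ "fst ` set n_as"]) force+
  show "degeneracy_index T \<nu> \<le> degeneracy_index T (of_real \<rho>)"
    if ev: "eigenvalue T \<nu>" and mod: "cmod \<nu> = \<rho>" for \<nu>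
  proof -
    have "{k. (k, \<nu>) \<in> set n_as} \<noteq> {}"
      using ev ev_iff by blast
    from Max_in[OF fin this] obtain t where
      "(Max {k. (k, \<nu>) \<in> set n_as}) \<le> t" "(t, of_real \<rho>) \<in> set n_as"
      using large[OF _ mod] by blast
    moreover from this have "t \<le> Max {k. (k, of_real \<rho>) \<in> set n_as}"
      by (intro Max_ge fin) simp
    ultimately show ?thesis
      unfolding degeneracy_index_eq[OF jnf] by linarith
  qed
qed

theorem theorem1p2:
  fixes n d :: nat and X :: "nat \<Rightarrow> complex mat" and T :: "complex mat"
  assumes "n \<ge> 1"
    and "\<And>i. i \<in> {1..d} \<Longrightarrow> X i \<in> carrier_mat n n"
    and "T = finsum (ring_mat TYPE(complex) (n * n) ()) (\<lambda>i. map_mat cnj (X i) \<otimes>\<^sub>K X i) {1..d}"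
  shows "(\<exists>\<mu>::real. \<mu> \<ge> 0 \<and> eigenvalue T (complex_of_real \<mu>) \<and>
            (\<forall>\<mu>'. eigenvalue T \<mu>' \<and> \<mu>' \<noteq> complex_of_real \<mu> \<longrightarrow>
               (\<mu> = cmod \<mu>' \<and>
                  degeneracy_index T (complex_of_real \<mu>) \<ge> degeneracy_index T \<mu>') \<or>
               \<mu> > cmod \<mu>'))
       \<and> (\<exists>\<mu>::real. \<mu> \<ge> 0 \<and> complex_of_real \<mu> \<in> maximal_spectrum T)"
proof -
  \<comment> \<open>The spectral radius is the witness for both conjuncts: an eigenvalue of that
    modulus falls under the degeneracy comparison, and any other has strictly smaller
    modulus.\<close>
  define \<rho> where "\<rho> = spectral_radius T"
  have T: "conj_kron_sum n T"
    unfolding assms(3) by (intro conj_kron_sum_finsum conj_kron_sum_kronecker assms(2)) auto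
  then have carr: "T \<in> carrier_mat (n * n) (n * n)"
    by (simp add: conj_kron_sum_def)
  have n2: "n * n > 0"
    using assms(1) by simp
  note dominant = conj_kron_sum_dominant_eigenvalue[OF assms(1) T, folded \<rho>_def]
  have max: "cmod \<nu> \<le> \<rho>" if "eigenvalue T \<nu>" for \<nu>
    using spectral_radius_mem_max(2)[OF carr n2] that unfolding \<rho>_def spectrum_def by blast
  have "\<rho> \<ge> 0"
    using max[OF dominant(1)] norm_ge_zero order_trans by blast
  moreover have "of_real \<rho> \<in> maximal_spectrum T"
    using dominant \<open>\<rho> \<ge> 0\<close> unfolding maximal_spectrum_def spectrum_def \<rho>_def[symmetric] by auto
  ultimately show ?thesis
    using dominant max by (metis order_le_less)
qed

end
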